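(* Consider the exponential family model $f_n(X^n|\eta)=\exp(\eta^\top T(X^n)-nA(\eta)-B(X^n))$ and conjugate prior $\pi(\eta)=\exp(\eta^\top\xi-\nu A(\eta)-\psi(\xi,\nu))$, $\eta\in H$. Suppose the model is well specified with true parameter value $\eta^*$ and that the characteristic function of the $\alpha_n$-posterior is continuous in $\xi_n$ and $\nu_n$ (defined in the context). If $\alpha_n n\to\alpha_0\ge0$ and $\frac1nT(X^n)\to g(\eta^* )$ in $f_{0,n}$-probability, then the $\alpha_n$-posterior converges weakly, in $f_{0,n}$-probability, to a distribution belonging to the same family as the prior, i.e. one with density of the form $\eta\mapsto\exp(\eta^\top\xi'-\nu'A(\eta)-\psi(\xi',\nu'))$ on $H$ for some parameters $(\xi',\nu')$.
   Context: $H$ is a natural parameter space; $B(X^n)$ is chosen so that $f_n(\cdot|\eta)$ integrates to one, and $\psi(\xi,\nu)$ so that $\pi$ integrates to one, i.e. $\psi(\xi,\nu)=\log\int_H\exp(\eta^\top\xi-\nu A(\eta))\,d\eta$. $f_{0,n}$ is the true density of the data $X^n$; well specified means $f_{0,n}=f_n(\cdot|\eta^* )$. $\alpha_n>0$ is a deterministic sequence. The $\alpha_n$-posterior is the distribution with density proportional to $f_n(X^n|\eta)^{\alpha_n}\pi(\eta)$, namely $$\pi_{n,\alpha_n}(\eta|X^n)=\exp\big(\eta^\top\xi_n-\nu_nA(\eta)-\psi(\xi_n,\nu_n)\big),\qquad \xi_n=\alpha_nT(X^n)+\xi,\quad \nu_n=\alpha_nn+\nu.$$ It is assumed proper. Its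 characteristic function is $t\mapsto\exp(\psi(it+\xi_n,\nu_n)-\psi(\xi_n,\nu_n))$, where $\exp\psi(it+\xi_n,\nu_n)$ stands for $\int_H\exp(\eta^\top(it+\xi_n)-\nu_nA(\eta))\,d\eta$. Weak convergence in $f_{0,n}$-probability of these random distributions means convergence in $f_{0,n}$-probability of their characteristic functions, pointwise in $t$, to that of the limit. *)

theory Defs
  imports "HOL-Probability.Probability"
begin

text \<open>
  For every sample size \<open>n \<ge> 1\<close> the data \<open>X\<^sup>n\<close> live in the space of a dominating measure \<open>\<mu> n\<close>,
  and \<open>T n\<close>, \<open>B n\<close> are functions on that space. All spaces share one carrier type \<open>'a\<close>
  (e.g.\ sequences, with \<open>\<mu> n\<close> a product measure over \<open>{..<n}\<close>). Nothing is required at \<open>n = 0\<close>.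
\<close>

definition expfam_density ::
  "(nat \<Rightarrow> 'a \<Rightarrow> real ^ 'd) \<Rightarrow> (real ^ 'd \<Rightarrow> real) \<Rightarrow> (nat \<Rightarrow> 'a \<Rightarrow> real) \<Rightarrow> nat \<Rightarrow> real ^ 'd \<Rightarrow> 'a \<Rightarrow> real"
  where "expfam_density T A B n \<eta> x = exp (\<eta> \<bullet> T n x - real n * A \<eta> - B n x)"

text \<open>For i.i.d.\ data the condition below is the same for all \<open>n\<close>.\<close>

definition natural_parameter_space ::
  "(nat \<Rightarrow> 'a measure) \<Rightarrow> (nat \<Rightarrow> 'a \<Rightarrow> real ^ 'd) \<Rightarrow> (nat \<Rightarrow> 'a \<Rightarrow> real) \<Rightarrow> (real ^ 'd) set"
  where "natural_parameter_space \<mu> T B =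
    {\<eta>. \<forall>n\<ge>1. integrable (\<mu> n) (\<lambda>x. exp (\<eta> \<bullet> T n x - B n x))}"

definition conj_log_normalizer ::
  "(real ^ 'd) set \<Rightarrow> (real ^ 'd \<Rightarrow> real) \<Rightarrow> real ^ 'd \<Rightarrow> real \<Rightarrow> real"
  where "conj_log_normalizer H A \<xi> \<nu> = ln (LINT \<eta>:H|lborel. exp (\<eta> \<bullet> \<xi> - \<nu> * A \<eta>))"

definition conj_density ::
  "(real ^ 'd) set \<Rightarrow> (real ^ 'd \<Rightarrow> real) \<Rightarrow> real ^ 'd \<Rightarrow> real \<Rightarrow> real ^ 'd \<Rightarrow> real"
  where "conj_density H A \<xi> \<nu> \<eta> = exp (\<eta> \<bullet> \<xi> - \<nu> * A \<eta> - conj_log_normalizer H A \<xi> \<nu>)"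

text \<open>
  This is a probability measure exactly when the integral defining \<open>conj_log_normalizer\<close> is
  finite and positive; in the degenerate cases the conventions for Bochner integrals and \<open>ln 0\<close>
  yield a measure of total mass \<open>\<infinity>\<close> or \<open>0\<close>.
\<close>

definition conj_dist ::
  "(real ^ 'd) set \<Rightarrow> (real ^ 'd \<Rightarrow> real) \<Rightarrow> real ^ 'd \<Rightarrow> real \<Rightarrow> (real ^ 'd) measure"
  where "conj_dist H A \<xi> \<nu> =
    density lborel (\<lambda>\<eta>. indicator H \<eta> * ennreal (conj_density H A \<xi> \<nu> \<eta>))"

text \<open>
  The distribution on \<open>H\<close> with density proportional to \<open>L(\<eta>)\<^sup>a p(\<eta>)\<close>. If the integral of the
  latter is infinite or zero the result is not a probability measure.
\<close>

definition alpha_posterior ::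
  "(real ^ 'd) set \<Rightarrow> (real ^ 'd \<Rightarrow> real) \<Rightarrow> (real ^ 'd \<Rightarrow> real) \<Rightarrow> real \<Rightarrow> (real ^ 'd) measure"
  where "alpha_posterior H L p a =
    density lborel (\<lambda>\<eta>. indicator H \<eta> *
      ennreal (L \<eta> powr a * p \<eta> / (LINT \<eta>':H|lborel. L \<eta>' powr a * p \<eta>')))"

definition char_vec :: "(real ^ 'd) measure \<Rightarrow> real ^ 'd \<Rightarrow> complex"
  where "char_vec M t = (CLINT \<eta>|M. iexp (t \<bullet> \<eta>))"

text \<open>
  Measurability is part of the definition, since \<^const>\<open>measure\<close> is \<open>0\<close> on non-measurable sets.
\<close>

definition converges_in_prob ::
  "(nat \<Rightarrow> 'a measure) \<Rightarrow> (nat \<Rightarrow> 'a \<Rightarrow> 'b :: metric_space) \<Rightarrow> 'b \<Rightarrow> bool"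
  where "converges_in_prob P Y c \<longleftrightarrow>
    (\<forall>n\<ge>1. Y n \<in> borel_measurable (P n)) \<and>
    (\<forall>\<epsilon>>0. (\<lambda>n. measure (P n) {x \<in> space (P n). dist (Y n x) c > \<epsilon>}) \<longlonglongrightarrow> 0)"

definition converges_weakly_in_prob ::
  "(nat \<Rightarrow> 'a measure) \<Rightarrow> (nat \<Rightarrow> 'a \<Rightarrow> (real ^ 'd) measure) \<Rightarrow> (real ^ 'd) measure \<Rightarrow> bool"
  where "converges_weakly_in_prob P Q M \<longleftrightarrow>
    (\<forall>t. converges_in_prob P (\<lambda>n x. char_vec (Q n x) t) (char_vec M t))"

lemma alpha_posterior_conj:
  assumes "prob_space (alpha_posterior H (\<lambda>\<eta>. expfam_density T A B n \<eta> x) (conj_density H A \<xi> \<nu>) a)"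
  shows "alpha_posterior H (\<lambda>\<eta>. expfam_density T A B n \<eta> x) (conj_density H A \<xi> \<nu>) a =
    conj_dist H A (a *\<^sub>R T n x + \<xi>) (a * real n + \<nu>)"
proof -
  define c where "c = exp (- a * B n x - conj_log_normalizer H A \<xi> \<nu>)"
  define h where "h = (\<lambda>\<eta>. exp (\<eta> \<bullet> (a *\<^sub>R T n x + \<xi>) - (a * real n + \<nu>) * A \<eta>))"
  define Z where "Z = (LINT \<eta>:H|lborel. h \<eta>)"
  have c: "c > 0" by (simp add: c_def)
  have eq: "expfam_density T A B n \<eta> x powr a * conj_density H A \<xi> \<nu> \<eta> = c * h \<eta>" for \<eta>
    by (simp add: expfam_density_def conj_density_def c_def h_def powr_def
        exp_add [symmetric] inner_right_distrib algebra_simps)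
  have post: "alpha_posterior H (\<lambda>\<eta>. expfam_density T A B n \<eta> x) (conj_density H A \<xi> \<nu>) a =
      density lborel (\<lambda>\<eta>. indicator H \<eta> * ennreal (h \<eta> / Z))"
    using c by (simp add: alpha_posterior_def eq Z_def)
  have "Z \<noteq> 0"
  proof
    assume "Z = 0"
    then have "emeasure (alpha_posterior H (\<lambda>\<eta>. expfam_density T A B n \<eta> x)
        (conj_density H A \<xi> \<nu>) a) UNIV = 0"
      unfolding post by (simp add: emeasure_density)
    with prob_space.emeasure_space_1 [OF assms] show False
      by (simp add: alpha_posterior_def)
  qed
  moreover have "Z \<ge> 0"
    unfolding Z_def set_lebesgue_integral_def h_def by (rule integral_nonneg_AE) simp
  ultimately have "h \<eta> / Z = conj_density H A (a *\<^sub>R T n x + \<xi>) (a * real n + \<nu>) \<eta>" for \<eta>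
    by (simp add: conj_density_def conj_log_normalizer_def Z_def h_def exp_diff)
  then show ?thesis
    by (simp add: post conj_dist_def)
qed

text \<open>
  The integral on the right is the meaning of \<open>exp (\<psi> (i t + \<xi>, \<nu>))\<close> for the log-normalizer \<open>\<psi>\<close>
  at a complex argument.
\<close>

lemma char_vec_conj_dist:
  assumes "(\<lambda>\<eta>. indicator H \<eta> * exp (\<eta> \<bullet> \<xi> - \<nu> * A \<eta>)) \<in> borel_measurable borel"
  shows "char_vec (conj_dist H A \<xi> \<nu>) t =
    (CLINT \<eta>:H|lborel. exp (\<i> * of_real (\<eta> \<bullet> t) + of_real (\<eta> \<bullet> \<xi> - \<nu> * A \<eta>)))
      * exp (- of_real (conj_log_normalizer H A \<xi> \<nu>))"
proof -
  let ?\<psi> = "conj_log_normalizer H A \<xi> \<nu>"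
  define k where "k = (\<lambda>\<eta>. indicator H \<eta> * exp (\<eta> \<bullet> \<xi> - \<nu> * A \<eta>) * exp (- ?\<psi>))"
  have k: "k \<in> borel_measurable lborel" "\<And>\<eta>. k \<eta> \<ge> 0"
    using borel_measurable_times [OF assms borel_measurable_const] by (simp_all add: k_def)
  have "conj_dist H A \<xi> \<nu> = density lborel (\<lambda>\<eta>. ennreal (k \<eta>))"
    unfolding conj_dist_def
    by (intro arg_cong [where f = "density lborel"] ext)
      (simp add: k_def conj_density_def exp_diff exp_minus divide_inverse indicator_def)
  then have "char_vec (conj_dist H A \<xi> \<nu>) t = (CLINT \<eta>|lborel. k \<eta> *\<^sub>R iexp (t \<bullet> \<eta>))"
    unfolding char_vec_def using k by (simp add: integral_density)
  also have "\<dots> = (CLINT \<eta>|lborel. (indicator H \<eta> *\<^sub>R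
      exp (\<i> * of_real (\<eta> \<bullet> t) + of_real (\<eta> \<bullet> \<xi> - \<nu> * A \<eta>))) * exp (- of_real ?\<psi>))"
    by (intro Bochner_Integration.integral_cong refl)
      (simp add: k_def scaleR_conv_of_real exp_of_real [symmetric] exp_add inner_commute
        mult_ac indicator_def)
  finally show ?thesis
    unfolding set_lebesgue_integral_def by (simp only: integral_mult_left_zero)
qed

end

theory Submission
  imports Defs
begin

text \<open>
  Up to factors free of \<open>\<eta>\<close>, the \<open>\<alpha>\<^sub>n\<close>-posterior has density
  \<open>exp (\<eta> \<bullet> \<xi>\<^sub>n - \<nu>\<^sub>n A(\<eta>))\<close> on \<open>H\<close>. Its parameters \<open>\<xi>\<^sub>n = (\<alpha>\<^sub>n n) (T\<^sub>n / n) + \<xi>\<close> and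
  \<open>\<nu>\<^sub>n = \<alpha>\<^sub>n n + \<nu>\<close> converge in probability to \<open>\<xi>' = \<alpha>\<^sub>0 g + \<xi>\<close> and \<open>\<nu>' = \<alpha>\<^sub>0 + \<nu>\<close>, where \<open>g\<close> is
  the limit of \<open>T\<^sub>n / n\<close>. The characteristic function is continuous on the set of proper
  parameters, so the continuous mapping theorem yields the claim as soon as \<open>(\<xi>', \<nu>')\<close>
  is itself proper.

  Properness of the limit is not automatic, because the set of proper parameters need not be
  closed. It holds since \<open>g\<close> is a subgradient of \<open>A\<close> at the true parameter \<open>\<eta>\<^sub>s\<close>. Indeed, tilting
  the true distribution from \<open>\<eta>\<^sub>s\<close> to \<open>\<eta> \<in> H\<close> gives
  \<open>E exp ((\<eta> - \<eta>\<^sub>s) \<bullet> T\<^sub>n) = exp (n (A(\<eta>) - A(\<eta>\<^sub>s)))\<close>, while \<open>T\<^sub>n\<close> is close to \<open>n g\<close> with probability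
  tending to one; comparing exponential rates (\<open>inner_limit_le_log_moment_rate\<close>) yields
  \<open>(\<eta> - \<eta>\<^sub>s) \<bullet> g \<le> A(\<eta>) - A(\<eta>\<^sub>s)\<close>. Hence the factor \<open>exp (\<alpha>\<^sub>0 (\<eta> \<bullet> g - A(\<eta>)))\<close>, by which the
  unnormalized limit density differs from that of the prior, is maximal over \<open>H\<close> at \<open>\<eta>\<^sub>s\<close>. The limit density
  is therefore dominated by a multiple of the prior density, and is integrable.

  Measurability in \<open>\<eta>\<close> also comes from tilting: \<open>H\<close> is the set where the moments
  \<open>E exp ((\<eta> - \<eta>\<^sub>s) \<bullet> T\<^sub>n)\<close>, \<open>n \<ge> 1\<close>, are finite, and on \<open>H\<close> the moment for \<open>n = 1\<close> determines \<open>A\<close>.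
  As integrals against probability measures, these moments are Borel functions of \<open>\<eta>\<close> by
  Tonelli's theorem.
\<close>

section \<open>Convergence in probability\<close>

text \<open>
  A continuous mapping theorem in which the map may vary with \<open>n\<close>. This absorbs the
  deterministic sequence \<open>\<alpha>\<^sub>n n\<close> into the map \<open>G n\<close>. The set \<open>E\<close> restricts continuity to the
  values that are attained almost surely, here the proper parameters.
\<close>

lemma converges_in_prob_mapping:
  fixes Y :: "nat \<Rightarrow> 'a \<Rightarrow> 'b :: metric_space" and V :: "nat \<Rightarrow> 'a \<Rightarrow> 'c :: metric_space"
  assumes prob: "\<And>n. n \<ge> 1 \<Longrightarrow> prob_space (P n)"
    and Y: "converges_in_prob P Y c"
    and V: "\<And>n. n \<ge> 1 \<Longrightarrow> V n \<in> borel_measurable (P n)"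
    and AE_eq: "\<And>n. n \<ge> 1 \<Longrightarrow> AE x in P n. (n, Y n x) \<in> E \<and> V n x = G n (Y n x)"
    and lim: "((\<lambda>(n, y). G n y) \<longlongrightarrow> v) (inf (sequentially \<times>\<^sub>F nhds c) (principal E))"
  shows "converges_in_prob P V v"
  unfolding converges_in_prob_def
proof (intro conjI allI impI V)
  fix \<epsilon> :: real assume "\<epsilon> > 0"
  have "\<forall>\<^sub>F (n, y) in sequentially \<times>\<^sub>F nhds c. (n, y) \<in> E \<longrightarrow> dist (G n y) v < \<epsilon>"
    using tendstoD [OF lim \<open>\<epsilon> > 0\<close>] by (simp add: eventually_inf_principal case_prod_unfold)
  then obtain Q R where Q: "eventually Q sequentially" and R: "eventually R (nhds c)"
    and QR: "\<And>n y. Q n \<Longrightarrow> R y \<Longrightarrow> (n, y) \<in> E \<longrightarrow> dist (G n y) v < \<epsilon>"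
    unfolding eventually_prod_filter by auto
  obtain d where "d > 0" and d: "\<And>y. dist y c < d \<Longrightarrow> R y"
    using R unfolding eventually_nhds_metric by auto
  have "(\<lambda>n. measure (P n) {x \<in> space (P n). dist (Y n x) c > d / 2}) \<longlonglongrightarrow> 0"
    using Y half_gt_zero [OF \<open>d > 0\<close>] unfolding converges_in_prob_def by blast
  then show "(\<lambda>n. measure (P n) {x \<in> space (P n). dist (V n x) v > \<epsilon>}) \<longlonglongrightarrow> 0"
  proof (rule tendsto_sandwich [where f = "\<lambda>_. 0", rotated 3])
    show "\<forall>\<^sub>F n in sequentially.
      measure (P n) {x \<in> space (P n). dist (V n x) v > \<epsilon>}
        \<le> measure (P n) {x \<in> space (P n). dist (Y n x) c > d / 2}"
    using Q eventually_ge_at_top [of 1]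
  proof eventually_elim
    case (elim n)
    interpret prob_space "P n" by (rule prob) fact
    have [measurable]: "Y n \<in> borel_measurable (P n)"
      using Y \<open>n \<ge> 1\<close> unfolding converges_in_prob_def by simp
    have [measurable]: "(\<lambda>x. dist (Y n x) c) \<in> borel_measurable (P n)"
      by (rule measurable_compose [OF \<open>Y n \<in> borel_measurable (P n)\<close>])
        (intro borel_measurable_continuous_onI continuous_intros)
    show ?case
    proof (rule finite_measure_mono_AE)
      show "AE x in P n. x \<in> {x \<in> space (P n). dist (V n x) v > \<epsilon>}
          \<longrightarrow> x \<in> {x \<in> space (P n). dist (Y n x) c > d / 2}"
        using AE_eq [OF \<open>n \<ge> 1\<close>]
      proof eventually_elim
        case (elim x)
        show ?case
        proof (cases "dist (Y n x) c < d")
          case True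
          then show ?thesis using QR [OF \<open>Q n\<close> d [OF True]] elim by auto
        next
          case False
          then show ?thesis using \<open>d > 0\<close> by auto
        qed
      qed
    qed measurable
  qed
  qed (simp_all add: tendsto_const)
qed

text \<open>
  On the event that \<open>T n / n\<close> is near \<open>g\<close>, which eventually has probability at least one half,
  \<open>exp (s \<bullet> T n)\<close> is at least \<open>exp (n (s \<bullet> g - e / 2))\<close>. If \<open>s \<bullet> g\<close> exceeded \<open>c\<close> by \<open>e\<close>, this
  contribution alone would outgrow the bound on the moment.
\<close>

lemma inner_limit_le_log_moment_rate:
  fixes T :: "nat \<Rightarrow> 'a \<Rightarrow> 'b :: euclidean_space"
  assumes prob: "\<And>n. n \<ge> 1 \<Longrightarrow> prob_space (P n)"
    and lim: "converges_in_prob P (\<lambda>n x. (1 / real n) *\<^sub>R T n x) g"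
    and moment: "\<And>n. n \<ge> 1 \<Longrightarrow>
      (\<integral>\<^sup>+ x. ennreal (exp (s \<bullet> T n x)) \<partial>P n) \<le> ennreal (exp (real n * c))"
  shows "s \<bullet> g \<le> c"
proof (rule field_le_epsilon)
  fix e :: real assume "e > 0"
  \<comment> \<open>Adding 1 to the norm covers the case \<open>s = 0\<close>.\<close>
  define \<epsilon> where "\<epsilon> = e / (2 * (norm s + 1))"
  have "\<epsilon> > 0" and "norm s * \<epsilon> \<le> e / 2"
    using \<open>e > 0\<close> by (auto simp: \<epsilon>_def field_simps add_pos_nonneg)
  let ?far = "\<lambda>n. {x \<in> space (P n). dist ((1 / real n) *\<^sub>R T n x) g > \<epsilon>}"
  have "(\<lambda>n. measure (P n) (?far n)) \<longlonglongrightarrow> 0"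
    using lim \<open>\<epsilon> > 0\<close> unfolding converges_in_prob_def by simp
  then have "\<forall>\<^sub>F n in sequentially. measure (P n) (?far n) < 1 / 2"
    by (rule order_tendstoD) simp
  \<comment> \<open>From here on, the factor \<open>1 / 2\<close> lost to the event costs at most \<open>e / 2\<close> in the rate.\<close>
  moreover have "\<forall>\<^sub>F n in sequentially. 2 * ln 2 / e \<le> real n"
    using filterlim_real_sequentially unfolding filterlim_at_top by simp
  ultimately have "\<forall>\<^sub>F n in sequentially. s \<bullet> g \<le> c + e"
    using eventually_ge_at_top [of 1]
  proof eventually_elim
    case (elim n)
    interpret prob_space "P n" by (rule prob) fact
    have [measurable]: "(\<lambda>x. (1 / real n) *\<^sub>R T n x) \<in> borel_measurable (P n)"
      using lim \<open>n \<ge> 1\<close> unfolding converges_in_prob_def by simp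
    let ?near = "{x \<in> space (P n). dist ((1 / real n) *\<^sub>R T n x) g \<le> \<epsilon>}"
    have "?near = space (P n) - ?far n" by auto
    then have half: "measure (P n) ?near \<ge> 1 / 2"
      using elim by (simp add: prob_compl)
    have pointwise: "exp (real n * (s \<bullet> g - e / 2)) \<le> exp (s \<bullet> T n x)" if "x \<in> ?near" for x
    proof -
      have "s \<bullet> (g - (1 / real n) *\<^sub>R T n x) \<le> norm s * norm (g - (1 / real n) *\<^sub>R T n x)"
        by (rule norm_cauchy_schwarz)
      also have "\<dots> \<le> norm s * \<epsilon>"
        using that by (intro mult_left_mono) (auto simp: dist_norm norm_minus_commute)
      also have "\<dots> \<le> e / 2" by fact
      finally have "s \<bullet> g - e / 2 \<le> (s \<bullet> T n x) / real n"
        by (simp add: inner_diff_right)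
      then have "real n * (s \<bullet> g - e / 2) \<le> real n * ((s \<bullet> T n x) / real n)"
        by (rule mult_left_mono) simp
      then show ?thesis
        using \<open>n \<ge> 1\<close> by simp
    qed
    have "ennreal (exp (real n * (s \<bullet> g - e / 2)) * (1 / 2))
        \<le> ennreal (exp (real n * (s \<bullet> g - e / 2)) * measure (P n) ?near)"
      using half by (intro ennreal_leI mult_left_mono) auto
    also have "\<dots> = (\<integral>\<^sup>+ x. ennreal (exp (real n * (s \<bullet> g - e / 2))) * indicator ?near x \<partial>P n)"
      by (simp add: nn_integral_cmult emeasure_eq_measure ennreal_mult)
    also have "\<dots> \<le> (\<integral>\<^sup>+ x. ennreal (exp (s \<bullet> T n x)) \<partial>P n)"
      by (intro nn_integral_mono) (use pointwise in \<open>auto simp: indicator_def\<close>)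
    also have "\<dots> \<le> ennreal (exp (real n * c))"
      by (rule moment) fact
    finally have "exp (real n * (s \<bullet> g - e / 2)) \<le> 2 * exp (real n * c)"
      by simp
    also have "\<dots> = exp (ln 2 + real n * c)"
      by (simp add: exp_add)
    finally have "real n * (s \<bullet> g - e / 2) \<le> ln 2 + real n * c"
      by simp
    moreover have "ln 2 \<le> real n * (e / 2)"
      using elim \<open>e > 0\<close> by (simp add: field_simps)
    ultimately have "real n * (s \<bullet> g) \<le> real n * (c + e)"
      by (simp add: algebra_simps)
    then show ?case
      using \<open>n \<ge> 1\<close> by simp
  qed
  then show "s \<bullet> g \<le> c + e" by simp
qed

section \<open>Tilting an exponential family\<close>

text \<open>
  Expressing the normalizing integral as a moment under a fixed member of the family trades the
  dominating measure \<open>M\<close>, which is arbitrary, for a measure that is finite when \<open>\<eta>'\<close> is a natural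
  parameter; Tonelli's theorem applies to the latter.
\<close>

lemma nn_integral_exp_tilt:
  assumes [measurable]: "T n \<in> borel_measurable M" "B n \<in> borel_measurable M"
  shows "(\<integral>\<^sup>+ x. ennreal (exp ((\<eta> - \<eta>') \<bullet> T n x))
        \<partial>density M (\<lambda>x. ennreal (expfam_density T A B n \<eta>' x)))
      = ennreal (exp (- real n * A \<eta>')) * (\<integral>\<^sup>+ x. ennreal (exp (\<eta> \<bullet> T n x - B n x)) \<partial>M)"
proof -
  have [measurable]: "expfam_density T A B n \<eta>' \<in> borel_measurable M"
    unfolding expfam_density_def by measurable
  have "expfam_density T A B n \<eta>' x * exp ((\<eta> - \<eta>') \<bullet> T n x)
      = exp (- real n * A \<eta>') * exp (\<eta> \<bullet> T n x - B n x)" for x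
    by (simp add: expfam_density_def inner_diff_left flip: exp_add)
  then have "(\<integral>\<^sup>+ x. ennreal (exp ((\<eta> - \<eta>') \<bullet> T n x))
        \<partial>density M (\<lambda>x. ennreal (expfam_density T A B n \<eta>' x)))
      = (\<integral>\<^sup>+ x. ennreal (exp (- real n * A \<eta>')) * ennreal (exp (\<eta> \<bullet> T n x - B n x)) \<partial>M)"
    by (simp add: nn_integral_density expfam_density_def flip: ennreal_mult)
  then show ?thesis
    by (simp add: nn_integral_cmult)
qed

lemma nn_integral_natural_parameter:
  assumes "\<eta> \<in> natural_parameter_space \<mu> T B" "n \<ge> 1"
    and "(LINT x|\<mu> n. expfam_density T A B n \<eta> x) = 1"
  shows "(\<integral>\<^sup>+ x. ennreal (exp (\<eta> \<bullet> T n x - B n x)) \<partial>\<mu> n) = ennreal (exp (real n * A \<eta>))"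
proof -
  have int: "integrable (\<mu> n) (\<lambda>x. exp (\<eta> \<bullet> T n x - B n x))"
    using assms unfolding natural_parameter_space_def by simp
  have "expfam_density T A B n \<eta> x = exp (- real n * A \<eta>) * exp (\<eta> \<bullet> T n x - B n x)" for x
    by (simp add: expfam_density_def flip: exp_add)
  with assms(3) have "exp (- real n * A \<eta>) * (LINT x|\<mu> n. exp (\<eta> \<bullet> T n x - B n x)) = 1"
    by simp
  then have "(LINT x|\<mu> n. exp (\<eta> \<bullet> T n x - B n x)) = exp (real n * A \<eta>)"
    by (simp add: exp_minus field_simps)
  then show ?thesis
    by (simp add: nn_integral_eq_integral [OF int])
qed

section \<open>The conjugate family\<close>

text \<open>
  The nontrivial point is that divergence of the integral cannot be masked by the normalizer: the
  Bochner integral is then \<open>0\<close>, and with \<open>ln 0 = 0\<close> the total mass is \<open>\<infinity>\<close>.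
\<close>

lemma prob_space_conj_dist_iff:
  fixes H :: "(real ^ 'd) set"
  assumes H: "H \<in> sets borel"
    and meas: "(\<lambda>\<eta>. indicator H \<eta> * exp (\<eta> \<bullet> \<xi> - \<nu> * A \<eta>)) \<in> borel_measurable borel"
  shows "prob_space (conj_dist H A \<xi> \<nu>) \<longleftrightarrow>
    set_integrable lborel H (\<lambda>\<eta>. exp (\<eta> \<bullet> \<xi> - \<nu> * A \<eta>)) \<and> H \<notin> null_sets lborel"
proof -
  define k where "k = (\<lambda>\<eta>. indicator H \<eta> * exp (\<eta> \<bullet> \<xi> - \<nu> * A \<eta>))"
  define Z where "Z = (LINT \<eta>|lborel. k \<eta>)"
  define I where "I = (\<integral>\<^sup>+ \<eta>. ennreal (k \<eta>) \<partial>lborel)"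
  have k [measurable]: "k \<in> borel_measurable borel"
    unfolding k_def by (fact meas)
  have k_nonneg: "k \<eta> \<ge> 0" for \<eta>
    by (simp add: k_def)
  have "indicator H \<eta> * ennreal (conj_density H A \<xi> \<nu> \<eta>) = ennreal (exp (- ln Z)) * ennreal (k \<eta>)" for \<eta>
    by (auto simp: indicator_def conj_density_def conj_log_normalizer_def Z_def k_def
        set_lebesgue_integral_def exp_diff exp_minus divide_inverse mult.commute simp flip: ennreal_mult)
  then have mass: "emeasure (conj_dist H A \<xi> \<nu>) (space (conj_dist H A \<xi> \<nu>)) = ennreal (exp (- ln Z)) * I"
    by (simp add: conj_dist_def emeasure_density nn_integral_cmult I_def)
  have integrable_iff: "set_integrable lborel H (\<lambda>\<eta>. exp (\<eta> \<bullet> \<xi> - \<nu> * A \<eta>)) \<longleftrightarrow> integrable lborel k"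
    by (simp add: set_integrable_def k_def)
  have I_0: "I = 0 \<longleftrightarrow> H \<in> null_sets lborel"
  proof -
    have "I = 0 \<longleftrightarrow> (AE \<eta> in lborel. ennreal (k \<eta>) = 0)"
      unfolding I_def by (rule nn_integral_0_iff_AE) simp
    also have "\<dots> \<longleftrightarrow> (AE \<eta> in lborel. \<eta> \<notin> H)"
      by (intro AE_cong) (simp add: k_def indicator_def)
    also have "\<dots> \<longleftrightarrow> H \<in> null_sets lborel"
      using H AE_iff_null_sets [of H lborel] by simp
    finally show ?thesis .
  qed
  show ?thesis
  proof (cases "integrable lborel k")
    case True
    have I: "I = ennreal Z"
      unfolding I_def Z_def by (rule nn_integral_eq_integral [OF True]) (simp add: k_nonneg)
    have "Z \<ge> 0"
      unfolding Z_def by (simp add: k_nonneg)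
    have "ennreal (exp (- ln Z)) * I = 1 \<longleftrightarrow> I \<noteq> 0"
    proof (cases "Z = 0")
      case False
      with \<open>Z \<ge> 0\<close> show ?thesis
        by (simp add: I exp_minus flip: ennreal_mult)
    qed (simp add: I)
    with True show ?thesis
      using prob_space.emeasure_space_1 prob_spaceI mass integrable_iff I_0 by metis
  next
    case False
    then have "\<not> I < \<infinity>"
      by (simp add: integrable_iff_bounded I_def k_nonneg)
    then have "I = \<infinity>"
      unfolding infinity_ennreal_def using top.not_eq_extremum by blast
    then have "ennreal (exp (- ln Z)) * I \<noteq> 1"
      by (simp add: ennreal_mult_top)
    with False show ?thesis
      using prob_space.emeasure_space_1 mass integrable_iff by metis
  qed
qed

text \<open>
  The representation through kernel \<open>k\<close> and mass \<open>Z\<close> holds at every data point, also where the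
  posterior is improper: there \<open>Z = 0\<close>, and both sides vanish because division by \<open>0\<close> gives \<open>0\<close>.
  The characteristic function is thus measurable on the whole sample space, as a parametrized
  integral.
\<close>

lemma borel_measurable_char_vec_posterior:
  fixes H :: "(real ^ 'd) set"
  assumes [measurable]: "T n \<in> borel_measurable M" "H \<in> sets borel"
    and A: "(\<lambda>\<eta>. indicator H \<eta> * A \<eta>) \<in> borel_measurable borel"
  shows "(\<lambda>x. char_vec (alpha_posterior H (\<lambda>\<eta>. expfam_density T A B n \<eta> x)
      (conj_density H A \<xi> \<nu>) a) t) \<in> borel_measurable M"
proof -
  \<comment> \<open>Outside \<open>H\<close> the function \<open>A\<close> is arbitrary; truncating it there leaves the kernel unchanged.\<close>
  define A' where "A' = (\<lambda>\<eta>. indicator H \<eta> * A \<eta>)"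
  have [measurable]: "A' \<in> borel_measurable borel"
    using A by (simp add: A'_def)
  define k where "k = (\<lambda>x \<eta>. indicator H \<eta> *
    exp (\<eta> \<bullet> (a *\<^sub>R T n x + \<xi>) - (a * real n + \<nu>) * A' \<eta>) :: real)"
  define Z where "Z = (\<lambda>x. LINT \<eta>|lborel. k x \<eta>)"
  have [measurable]: "(\<lambda>(x, \<eta>). k x \<eta>) \<in> borel_measurable (M \<Otimes>\<^sub>M lborel)"
    unfolding k_def by measurable
  have [measurable]: "Z \<in> borel_measurable M"
    unfolding Z_def by measurable
  have "char_vec (alpha_posterior H (\<lambda>\<eta>. expfam_density T A B n \<eta> x) (conj_density H A \<xi> \<nu>) a) t
      = (CLINT \<eta>|lborel. (k x \<eta> / Z x) *\<^sub>R iexp (t \<bullet> \<eta>))" for x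
  proof -
    define c where "c = exp (- a * B n x - conj_log_normalizer H A \<xi> \<nu>)"
    have "c > 0" by (simp add: c_def)
    have k_eq: "indicator H \<eta> * (expfam_density T A B n \<eta> x powr a * conj_density H A \<xi> \<nu> \<eta>)
        = c * k x \<eta>" for \<eta>
      by (simp add: expfam_density_def conj_density_def c_def k_def A'_def powr_def indicator_def
          exp_add [symmetric] inner_right_distrib algebra_simps)
    have Z_eq: "(LINT \<eta>:H|lborel. expfam_density T A B n \<eta> x powr a * conj_density H A \<xi> \<nu> \<eta>)
        = c * Z x"
      by (simp add: set_lebesgue_integral_def k_eq Z_def)
    have "alpha_posterior H (\<lambda>\<eta>. expfam_density T A B n \<eta> x) (conj_density H A \<xi> \<nu>) a
        = density lborel (\<lambda>\<eta>. ennreal (k x \<eta> / Z x))"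
      unfolding alpha_posterior_def Z_eq
    proof (intro arg_cong [where f = "density lborel"] ext)
      fix \<eta>
      show "indicator H \<eta> * ennreal (expfam_density T A B n \<eta> x powr a * conj_density H A \<xi> \<nu> \<eta> / (c * Z x))
          = ennreal (k x \<eta> / Z x)"
        using k_eq [of \<eta>] \<open>c > 0\<close> by (cases "\<eta> \<in> H") (auto simp: k_def)
    qed
    moreover have "k x \<eta> / Z x \<ge> 0" for \<eta>
      unfolding Z_def by (intro divide_nonneg_nonneg integral_nonneg_AE) (auto simp: k_def)
    moreover have "k x \<in> borel_measurable borel"
      unfolding k_def by measurable
    ultimately show ?thesis
      unfolding char_vec_def by (simp add: integral_density)
  qed
  then show ?thesis by simp
qed

section \<open>Convergence of the posterior\<close>

theorem proposition1:
  fixes \<mu> :: "nat \<Rightarrow> 'a measure"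
    and T :: "nat \<Rightarrow> 'a \<Rightarrow> real ^ 'd"
    and A :: "real ^ 'd \<Rightarrow> real"
    and B :: "nat \<Rightarrow> 'a \<Rightarrow> real"
    and H :: "(real ^ 'd) set"
    and f\<^sub>0 :: "nat \<Rightarrow> 'a \<Rightarrow> real"
    and P :: "nat \<Rightarrow> 'a measure"
    and \<xi> :: "real ^ 'd" and \<nu> :: real
    and \<eta>\<^sub>s :: "real ^ 'd"
    and g :: "real ^ 'd \<Rightarrow> real ^ 'd"
    and \<alpha> :: "nat \<Rightarrow> real" and \<alpha>\<^sub>0 :: real
    and post :: "nat \<Rightarrow> 'a \<Rightarrow> (real ^ 'd) measure"
  defines "P \<equiv> \<lambda>n. density (\<mu> n) (\<lambda>x. ennreal (f\<^sub>0 n x))"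
    and "post \<equiv> \<lambda>n x. alpha_posterior H (\<lambda>\<eta>. expfam_density T A B n \<eta> x)
                         (conj_density H A \<xi> \<nu>) (\<alpha> n)"
  assumes T_meas: "\<And>n. n \<ge> 1 \<Longrightarrow> T n \<in> borel_measurable (\<mu> n)"
    and B_meas: "\<And>n. n \<ge> 1 \<Longrightarrow> B n \<in> borel_measurable (\<mu> n)"
    and H: "H = natural_parameter_space \<mu> T B"
    and normalized: "\<And>n \<eta>. n \<ge> 1 \<Longrightarrow> \<eta> \<in> H \<Longrightarrow> (LINT x|\<mu> n. expfam_density T A B n \<eta> x) = 1"
    and prior_proper: "prob_space (conj_dist H A \<xi> \<nu>)"
    and true_param: "\<eta>\<^sub>s \<in> H"
    and f0_meas: "\<And>n. n \<ge> 1 \<Longrightarrow> f\<^sub>0 n \<in> borel_measurable (\<mu> n)"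
    and well_specified: "\<And>n. n \<ge> 1 \<Longrightarrow> AE x in \<mu> n. f\<^sub>0 n x = expfam_density T A B n \<eta>\<^sub>s x"
    and \<alpha>_pos: "\<And>n. n \<ge> 1 \<Longrightarrow> \<alpha> n > 0"
    and posterior_proper: "\<And>n. n \<ge> 1 \<Longrightarrow> AE x in P n. prob_space (post n x)"
    and char_continuous: "\<And>t. continuous_on {(\<xi>', \<nu>'). prob_space (conj_dist H A \<xi>' \<nu>')}
                                (\<lambda>(\<xi>', \<nu>'). char_vec (conj_dist H A \<xi>' \<nu>') t)"
    and \<alpha>\<^sub>0_nonneg: "\<alpha>\<^sub>0 \<ge> 0"
    and \<alpha>_lim: "(\<lambda>n. \<alpha> n * real n) \<longlonglongrightarrow> \<alpha>\<^sub>0"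
    and T_lim: "converges_in_prob P (\<lambda>n x. (1 / real n) *\<^sub>R T n x) (g \<eta>\<^sub>s)"
  shows "\<exists>\<xi>' \<nu>'. prob_space (conj_dist H A \<xi>' \<nu>') \<and>
           converges_weakly_in_prob P post (conj_dist H A \<xi>' \<nu>')"
proof -
  have P_eq: "P n = density (\<mu> n) (\<lambda>x. ennreal (expfam_density T A B n \<eta>\<^sub>s x))" if "n \<ge> 1" for n
  proof -
    have [measurable]: "T n \<in> borel_measurable (\<mu> n)" "B n \<in> borel_measurable (\<mu> n)"
      "f\<^sub>0 n \<in> borel_measurable (\<mu> n)"
      using that T_meas B_meas f0_meas by auto
    have [measurable]: "expfam_density T A B n \<eta>\<^sub>s \<in> borel_measurable (\<mu> n)"
      unfolding expfam_density_def by measurable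
    show ?thesis
      unfolding P_def using well_specified [OF that] by (intro density_cong) auto
  qed
  define L where "L = (\<lambda>n \<eta>. \<integral>\<^sup>+ x. ennreal (exp ((\<eta> - \<eta>\<^sub>s) \<bullet> T n x)) \<partial>P n)"
  have L_eq: "L n \<eta> = ennreal (exp (- real n * A \<eta>\<^sub>s)) *
      (\<integral>\<^sup>+ x. ennreal (exp (\<eta> \<bullet> T n x - B n x)) \<partial>\<mu> n)" if "n \<ge> 1" for n \<eta>
    unfolding L_def P_eq [OF that] using that by (intro nn_integral_exp_tilt T_meas B_meas)
  have L_H: "L n \<eta> = ennreal (exp (real n * (A \<eta> - A \<eta>\<^sub>s)))" if "n \<ge> 1" "\<eta> \<in> H" for n \<eta>
    using that unfolding L_eq [OF that(1)]
    by (subst nn_integral_natural_parameter [where A = A])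
      (auto simp: H normalized algebra_simps simp flip: ennreal_mult exp_add)
  have prob: "prob_space (P n)" if "n \<ge> 1" for n
    using L_H [OF that true_param] by (intro prob_spaceI) (simp add: L_def)
  have T_P [measurable]: "T n \<in> borel_measurable (P n)" if "n \<ge> 1" for n
    using T_meas [OF that] by (simp add: P_def)

  have L_meas: "L n \<in> borel_measurable borel" if "n \<ge> 1" for n
  proof -
    interpret prob_space "P n" by (rule prob) fact
    note [measurable] = T_P [OF that]
    show ?thesis unfolding L_def by measurable
  qed
  have "\<eta> \<in> H \<longleftrightarrow> (\<forall>n\<in>{1..}. L n \<eta> < \<infinity>)" for \<eta>
  proof -
    have "integrable (\<mu> n) (\<lambda>x. exp (\<eta> \<bullet> T n x - B n x)) \<longleftrightarrow> L n \<eta> < \<infinity>" if "n \<ge> 1" for n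
    proof -
      note [measurable] = T_meas [OF that] B_meas [OF that]
      show ?thesis
        by (auto simp: integrable_iff_bounded L_eq [OF that] ennreal_mult_less_top)
    qed
    then show ?thesis by (auto simp: H natural_parameter_space_def)
  qed
  then have "H = (\<Inter>n\<in>{1..}. {\<eta>. L n \<eta> < \<infinity>})" by auto
  also have "\<dots> \<in> sets borel"
  proof (intro sets.countable_INT'')
    fix n :: nat assume "n \<in> {1..}"
    then have [measurable]: "L n \<in> borel_measurable borel"
      by (simp add: L_meas)
    have "{\<eta> \<in> space borel. L n \<eta> < \<infinity>} \<in> sets borel"
      by measurable
    then show "{\<eta>. L n \<eta> < \<infinity>} \<in> sets borel"
      by simp
  qed simp_all
  finally have H_borel [measurable]: "H \<in> sets borel" .

  have "indicator H \<eta> * A \<eta> = indicator H \<eta> * (A \<eta>\<^sub>s + ln (enn2real (L 1 \<eta>)))" for \<eta>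
    by (simp add: indicator_def L_H)
  moreover have "(\<lambda>\<eta>. indicator H \<eta> * (A \<eta>\<^sub>s + ln (enn2real (L 1 \<eta>)))) \<in> borel_measurable borel"
    using L_meas [of 1] by simp
  ultimately have A_borel: "(\<lambda>\<eta>. indicator H \<eta> * A \<eta>) \<in> borel_measurable borel"
    by presburger
  define A' where "A' = (\<lambda>\<eta>. indicator H \<eta> * A \<eta>)"
  have [measurable]: "A' \<in> borel_measurable borel"
    using A_borel by (simp only: A'_def)
  have kernel_borel: "(\<lambda>\<eta>. indicator H \<eta> * exp (\<eta> \<bullet> \<xi>' - \<nu>' * A \<eta>)) \<in> borel_measurable borel"
    for \<xi>' \<nu>'
  proof -
    have "indicator H \<eta> * exp (\<eta> \<bullet> \<xi>' - \<nu>' * A \<eta>) = indicator H \<eta> * exp (\<eta> \<bullet> \<xi>' - \<nu>' * A' \<eta>)" for \<eta>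
      by (simp add: A'_def indicator_def)
    moreover have "(\<lambda>\<eta>. indicator H \<eta> * exp (\<eta> \<bullet> \<xi>' - \<nu>' * A' \<eta>)) \<in> borel_measurable borel"
      by measurable
    ultimately show ?thesis by presburger
  qed
  note proper_iff = prob_space_conj_dist_iff [OF H_borel kernel_borel]

  define \<xi>' where "\<xi>' = \<alpha>\<^sub>0 *\<^sub>R g \<eta>\<^sub>s + \<xi>"
  define \<nu>' where "\<nu>' = \<alpha>\<^sub>0 + \<nu>"
  \<comment> \<open>the proper parameters, on which the characteristic function is continuous\<close>
  define D where "D = {(\<xi>', \<nu>'). prob_space (conj_dist H A \<xi>' \<nu>')}"

  have subgradient: "(\<eta> - \<eta>\<^sub>s) \<bullet> g \<eta>\<^sub>s \<le> A \<eta> - A \<eta>\<^sub>s" if "\<eta> \<in> H" for \<eta>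
    using prob T_lim
  proof (rule inner_limit_le_log_moment_rate)
    fix n :: nat assume "n \<ge> 1"
    then show "(\<integral>\<^sup>+ x. ennreal (exp ((\<eta> - \<eta>\<^sub>s) \<bullet> T n x)) \<partial>P n)
        \<le> ennreal (exp (real n * (A \<eta> - A \<eta>\<^sub>s)))"
      using L_H that by (simp add: L_def)
  qed
  have limit_proper: "prob_space (conj_dist H A \<xi>' \<nu>')"
    unfolding proper_iff
  proof
    \<comment> \<open>the maximum over \<open>H\<close> of the ratio of the limit kernel to the prior kernel\<close>
    define C where "C = exp (\<alpha>\<^sub>0 * (\<eta>\<^sub>s \<bullet> g \<eta>\<^sub>s - A \<eta>\<^sub>s))"
    have prior_int: "integrable lborel (\<lambda>\<eta>. C * (indicator H \<eta> * exp (\<eta> \<bullet> \<xi> - \<nu> * A \<eta>)))"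
      using prior_proper unfolding proper_iff by (simp add: set_integrable_def)
    show "set_integrable lborel H (\<lambda>\<eta>. exp (\<eta> \<bullet> \<xi>' - \<nu>' * A \<eta>))"
      unfolding set_integrable_def real_scaleR_def
    proof (rule Bochner_Integration.integrable_bound [OF prior_int])
      show "AE \<eta> in lborel. norm (indicator H \<eta> * exp (\<eta> \<bullet> \<xi>' - \<nu>' * A \<eta>))
          \<le> norm (C * (indicator H \<eta> * exp (\<eta> \<bullet> \<xi> - \<nu> * A \<eta>)))"
      proof (rule AE_I2)
        fix \<eta>
        have "\<alpha>\<^sub>0 * (\<eta> \<bullet> g \<eta>\<^sub>s - A \<eta>) \<le> \<alpha>\<^sub>0 * (\<eta>\<^sub>s \<bullet> g \<eta>\<^sub>s - A \<eta>\<^sub>s)" if "\<eta> \<in> H"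
          using subgradient [OF that] \<alpha>\<^sub>0_nonneg
          by (intro mult_left_mono) (auto simp: inner_diff_left)
        then show "norm (indicator H \<eta> * exp (\<eta> \<bullet> \<xi>' - \<nu>' * A \<eta>))
            \<le> norm (C * (indicator H \<eta> * exp (\<eta> \<bullet> \<xi> - \<nu> * A \<eta>)))"
          by (auto simp: indicator_def C_def \<xi>'_def \<nu>'_def inner_right_distrib algebra_simps
              simp flip: exp_add)
      qed
    qed (use kernel_borel in simp)
    show "H \<notin> null_sets lborel"
      using prior_proper unfolding proper_iff by simp
  qed

  have "converges_in_prob P (\<lambda>n x. char_vec (post n x) t) (char_vec (conj_dist H A \<xi>' \<nu>') t)" for t
  proof -
    define F where "F = (\<lambda>(\<xi>', \<nu>'). char_vec (conj_dist H A \<xi>' \<nu>') t)"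
    define \<Phi> where "\<Phi> = (\<lambda>(n, y). ((\<alpha> n * real n) *\<^sub>R y + \<xi>, \<alpha> n * real n + \<nu>))"
    have "(\<Phi> \<longlongrightarrow> (\<xi>', \<nu>')) (sequentially \<times>\<^sub>F nhds (g \<eta>\<^sub>s))"
    proof -
      have \<alpha>: "((\<lambda>p. \<alpha> (fst p) * real (fst p)) \<longlongrightarrow> \<alpha>\<^sub>0) (sequentially \<times>\<^sub>F nhds (g \<eta>\<^sub>s))"
        by (rule filterlim_compose [OF \<alpha>_lim filterlim_fst])
      show ?thesis
        unfolding \<Phi>_def case_prod_unfold \<xi>'_def \<nu>'_def
        by (rule tendsto_Pair [OF tendsto_add [OF tendsto_scaleR [OF \<alpha> filterlim_snd] tendsto_const]
            tendsto_add [OF \<alpha> tendsto_const]])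
    qed
    then have \<Phi>: "filterlim \<Phi> (inf (nhds (\<xi>', \<nu>')) (principal D))
        (inf (sequentially \<times>\<^sub>F nhds (g \<eta>\<^sub>s)) (principal (\<Phi> -` D)))"
      unfolding filterlim_inf filterlim_principal eventually_inf_principal
      by (auto intro: filterlim_mono [OF _ order_refl inf_le1])
    have "(F \<longlongrightarrow> F (\<xi>', \<nu>')) (inf (nhds (\<xi>', \<nu>')) (principal D))"
    proof -
      have "(F \<longlongrightarrow> F (\<xi>', \<nu>')) (at (\<xi>', \<nu>') within D)"
        using char_continuous [of t] limit_proper
        unfolding continuous_on_def F_def D_def by auto
      then show ?thesis
        by (simp only: tendsto_at_within_iff_tendsto_nhds)
    qed
    from filterlim_compose [OF this \<Phi>] have lim: "((\<lambda>(n, y). F (\<Phi> (n, y))) \<longlongrightarrow> F (\<xi>', \<nu>'))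
        (inf (sequentially \<times>\<^sub>F nhds (g \<eta>\<^sub>s)) (principal (\<Phi> -` D)))"
      by (simp add: case_prod_unfold)
    have "converges_in_prob P (\<lambda>n x. char_vec (post n x) t) (F (\<xi>', \<nu>'))"
      using prob T_lim _ _ lim
    proof (rule converges_in_prob_mapping)
      fix n :: nat assume "n \<ge> 1"
      show "(\<lambda>x. char_vec (post n x) t) \<in> borel_measurable (P n)"
        unfolding post_def
        by (rule borel_measurable_char_vec_posterior [where T = T and A = A,
            OF T_P [OF \<open>n \<ge> 1\<close>] H_borel A_borel])
      show "AE x in P n. (n, (1 / real n) *\<^sub>R T n x) \<in> \<Phi> -` D \<and>
          char_vec (post n x) t = F (\<Phi> (n, (1 / real n) *\<^sub>R T n x))"
        using posterior_proper [OF \<open>n \<ge> 1\<close>]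
      proof eventually_elim
        case (elim x)
        have "\<Phi> (n, (1 / real n) *\<^sub>R T n x) = (\<alpha> n *\<^sub>R T n x + \<xi>, \<alpha> n * real n + \<nu>)"
          using \<open>n \<ge> 1\<close> by (simp add: \<Phi>_def)
        with elim alpha_posterior_conj [OF elim [unfolded post_def]] show ?case
          by (simp add: post_def D_def F_def)
      qed
    qed
    then show ?thesis by (simp add: F_def)
  qed
  with limit_proper show ?thesis
    unfolding converges_weakly_in_prob_def by blast
qed

end
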